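(* Let $1\le p<\infty$. If a symmetric function space $E(0,\infty)$ is isometric (via a surjective linear isometry) to $L_p(0,\infty)$, then it coincides with $L_p(0,\infty)$ and $\|\cdot\|_E=\lambda\|\cdot\|_{L_p}$ for some $\lambda>0$.
   Context: All Banach spaces are complex. $S(0,\infty)$ is the space of measurable functions $f$ on $(0,\infty)$ with $m(\{|f|>s\})<\infty$ for some $s>0$, and $\mu(f)$ is the decreasing rearrangement of $|f|$. A symmetric function space $E(0,\infty)$ is a linear subspace of $S(0,\infty)$ with a complete norm $\|\cdot\|_E$ such that $f\in E(0,\infty)$, $g\in S(0,\infty)$ and $\mu(g)\le\mu(f)$ imply $g\in E(0,\infty)$ and $\|g\|_E\le\|f\|_E$. *)

theory Defs
  imports "HOL-Analysis.Analysis"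
begin

text \<open>
  Elements of a function space on the half-line are classes of measurable functions modulo equality
  almost everywhere. They are handled through representatives: a space is a set of total functions
  (values outside the half-line are irrelevant), its norm is a function on representatives, and
  equations between elements are stated almost everywhere.
\<close>

abbreviation half_line :: "real measure" where
  "half_line \<equiv> lebesgue_on {0<..}"

definition S_space :: "(real \<Rightarrow> complex) set" where
  "S_space = {f \<in> borel_measurable half_line.
     \<exists>s>0. emeasure half_line {x \<in> space half_line. s < cmod (f x)} < \<infinity>}"

text \<open>
  For \<open>f \<in> S_space\<close> and \<open>t > 0\<close> the set below is nonempty, so the infimum is the usual one.
  For \<open>t = 0\<close> it may be empty; only \<open>t > 0\<close> is used.
\<close>

definition rearrangement :: "(real \<Rightarrow> complex) \<Rightarrow> real \<Rightarrow> real" where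
  "rearrangement f t =
     Inf {s. 0 \<le> s \<and> emeasure half_line {x \<in> space half_line. s < cmod (f x)} \<le> ennreal t}"

definition linear_subspace :: "(real \<Rightarrow> complex) set \<Rightarrow> bool" where
  "linear_subspace E \<longleftrightarrow> E \<subseteq> S_space \<and> (\<lambda>x. 0) \<in> E \<and>
     (\<forall>f\<in>E. \<forall>g\<in>E. (\<lambda>x. f x + g x) \<in> E) \<and> (\<forall>c. \<forall>f\<in>E. (\<lambda>x. c * f x) \<in> E)"

definition norm_on :: "(real \<Rightarrow> complex) set \<Rightarrow> ((real \<Rightarrow> complex) \<Rightarrow> real) \<Rightarrow> bool" where
  "norm_on E N \<longleftrightarrow>
     (\<forall>f\<in>E. 0 \<le> N f \<and> (N f = 0 \<longleftrightarrow> (AE x in half_line. f x = 0))) \<and>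
     (\<forall>f\<in>E. \<forall>g\<in>E. N (\<lambda>x. f x + g x) \<le> N f + N g) \<and>
     (\<forall>c. \<forall>f\<in>E. N (\<lambda>x. c * f x) = cmod c * N f)"

definition complete_norm_on :: "(real \<Rightarrow> complex) set \<Rightarrow> ((real \<Rightarrow> complex) \<Rightarrow> real) \<Rightarrow> bool" where
  "complete_norm_on E N \<longleftrightarrow> norm_on E N \<and>
     (\<forall>u :: nat \<Rightarrow> real \<Rightarrow> complex.
        (\<forall>n. u n \<in> E) \<and> (\<forall>e>0. \<exists>K. \<forall>m\<ge>K. \<forall>n\<ge>K. N (\<lambda>x. u m x - u n x) < e) \<longrightarrow>
        (\<exists>f\<in>E. (\<lambda>n. N (\<lambda>x. u n x - f x)) \<longlonglongrightarrow> 0))"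

definition symmetric_function_space ::
    "(real \<Rightarrow> complex) set \<Rightarrow> ((real \<Rightarrow> complex) \<Rightarrow> real) \<Rightarrow> bool" where
  "symmetric_function_space E N \<longleftrightarrow> linear_subspace E \<and> complete_norm_on E N \<and>
     (\<forall>f\<in>E. \<forall>g\<in>S_space. (\<forall>t>0. rearrangement g t \<le> rearrangement f t) \<longrightarrow> g \<in> E \<and> N g \<le> N f)"

definition Lp_space :: "real \<Rightarrow> (real \<Rightarrow> complex) set" where
  "Lp_space p = {f \<in> borel_measurable half_line. integrable half_line (\<lambda>x. cmod (f x) powr p)}"

definition Lp_norm :: "real \<Rightarrow> (real \<Rightarrow> complex) \<Rightarrow> real" where
  "Lp_norm p f = (\<integral>x. cmod (f x) powr p \<partial>half_line) powr (1 / p)"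

text \<open>
  Linearity and norm preservation force \<open>T\<close> to respect equality almost everywhere, so \<open>T\<close> below
  induces a surjective linear isometry of the spaces of classes; every such isometry arises by
  choosing representatives.
\<close>

definition surjective_linear_isometry ::
    "((real \<Rightarrow> complex) \<Rightarrow> (real \<Rightarrow> complex)) \<Rightarrow>
     (real \<Rightarrow> complex) set \<Rightarrow> ((real \<Rightarrow> complex) \<Rightarrow> real) \<Rightarrow>
     (real \<Rightarrow> complex) set \<Rightarrow> ((real \<Rightarrow> complex) \<Rightarrow> real) \<Rightarrow> bool" where
  "surjective_linear_isometry T E N F M \<longleftrightarrow>
     (\<forall>f\<in>E. T f \<in> F) \<and>
     (\<forall>f\<in>E. \<forall>g\<in>E. AE x in half_line. T (\<lambda>y. f y + g y) x = T f x + T g x) \<and>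
     (\<forall>c. \<forall>f\<in>E. AE x in half_line. T (\<lambda>y. c * f y) x = c * T f x) \<and>
     (\<forall>f\<in>E. M (T f) = N f) \<and>
     (\<forall>h\<in>F. \<exists>f\<in>E. AE x in half_line. T f x = h x)"

definition isometric_spaces ::
    "(real \<Rightarrow> complex) set \<Rightarrow> ((real \<Rightarrow> complex) \<Rightarrow> real) \<Rightarrow>
     (real \<Rightarrow> complex) set \<Rightarrow> ((real \<Rightarrow> complex) \<Rightarrow> real) \<Rightarrow> bool" where
  "isometric_spaces E N F M \<longleftrightarrow> (\<exists>T. surjective_linear_isometry T E N F M)"

text \<open>Membership in a symmetric function space and the norm depend only on the class.\<close>

lemma rearrangement_cong_AE:
  assumes "f \<in> borel_measurable half_line" "g \<in> borel_measurable half_line"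
    and "AE x in half_line. f x = g x"
  shows "rearrangement f t = rearrangement g t"
proof -
  have [measurable]: "f \<in> borel_measurable half_line" "g \<in> borel_measurable half_line"
    using assms by auto
  have "emeasure half_line {x \<in> space half_line. s < cmod (f x)} =
        emeasure half_line {x \<in> space half_line. s < cmod (g x)}" for s
    by (rule emeasure_eq_AE, use assms(3) in force) measurable
  then show ?thesis
    by (simp only: rearrangement_def)
qed

lemma symmetric_function_space_AE:
  assumes E: "symmetric_function_space E N" and f: "f \<in> E"
    and g: "g \<in> borel_measurable half_line" and eq: "AE x in half_line. f x = g x"
  shows "g \<in> E" "N g = N f"
proof -
  have fS: "f \<in> S_space"
    using E f by (auto simp: symmetric_function_space_def linear_subspace_def)
  then have fm: "f \<in> borel_measurable half_line"
    by (simp add: S_space_def)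
  note [measurable] = fm g
  have "emeasure half_line {x \<in> space half_line. s < cmod (f x)} =
        emeasure half_line {x \<in> space half_line. s < cmod (g x)}" for s
    by (rule emeasure_eq_AE, use eq in force) measurable
  with fS g have gS: "g \<in> S_space"
    by (simp add: S_space_def)
  have r: "rearrangement f t = rearrangement g t" for t
    by (rule rearrangement_cong_AE[OF fm g eq])
  have dom: "\<And>f g. f \<in> E \<Longrightarrow> g \<in> S_space \<Longrightarrow> (\<forall>t>0. rearrangement g t \<le> rearrangement f t) \<Longrightarrow>
      g \<in> E \<and> N g \<le> N f"
    using E unfolding symmetric_function_space_def by blast
  show gE: "g \<in> E"
    using dom[OF f gS] r by simp
  show "N g = N f"
    using dom[OF f gS] dom[OF gE fS] r by (auto intro: antisym)
qed

end

theory Submission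
  imports Defs
begin

text \<open>
  For \<open>p \<noteq> 2\<close> the equality case of Clarkson's inequality lets the norm of \<open>L\<^sub>p\<close> detect disjointness.
  Multiplying \<open>f \<in> E\<close> on the complement of a set \<open>A\<close> by a unimodular constant \<open>l\<close> preserves the norm of \<open>E\<close>;
  hence disjointness of \<open>T f\<close> and \<open>T g\<close> is kept when \<open>f\<close> and \<open>g\<close> are both twisted in this way, and
  comparing coefficients in \<open>l\<close> shows that it is kept by cutting \<open>f\<close> and \<open>g\<close> to the same set. Therefore
  \<open>T\<close> maps the functions of \<open>E\<close> supported in \<open>A\<close> onto a space that is invariant under multiplication by
  indicators. If now \<open>F\<close> and \<open>G\<close> are images of functions supported in \<open>A\<close> and in its complement, then
  \<open>F + l G\<close> has on every set an integral of the \<open>p\<close>-th power of its modulus that does not depend on \<open>l\<close>, so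
  \<open>|F + l G|\<close> itself does not depend on \<open>l\<close> and \<open>F G = 0\<close>. Thus the \<open>p\<close>-th power of the norm of \<open>E\<close> is additive
  over disjoint supports (for \<open>p = 2\<close> this is the parallelogram law). By symmetry it is then a multiple of
  Lebesgue measure on indicators, and completeness extends this to all of \<open>L\<^sub>p\<close>.
\<close>

section \<open>Distribution functions and rearrangements\<close>

text \<open>Continuity from above along the levels \<open>s + real n\<close>: the superlevel sets
  have finite measure and decrease to the empty set, since \<open>f\<close> has finite values. So
  for \<open>t > 0\<close> the infimum defining \<open>rearrangement f t\<close> is over a nonempty
  set.\<close>

lemma rearrangement_bound_exists:
  assumes f: "f \<in> S_space" and t: "0 < t"
  shows "\<exists>s\<ge>0. emeasure half_line {x \<in> space half_line. s < cmod (f x)} \<le> ennreal t"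
proof -
  have [measurable]: "f \<in> borel_measurable half_line"
    using f by (simp add: S_space_def)
  obtain s where s: "s > 0" "emeasure half_line {x \<in> space half_line. s < cmod (f x)} < \<infinity>"
    using f by (auto simp: S_space_def)
  define B where "B n = {x \<in> space half_line. s + real n < cmod (f x)}" for n
  have "(\<lambda>n. emeasure half_line (B n)) \<longlonglongrightarrow> emeasure half_line (\<Inter>n. B n)"
  proof (rule Lim_emeasure_decseq)
    show "range B \<subseteq> sets half_line"
    proof -
      have "B n \<in> sets half_line" for n
        unfolding B_def by measurable
      then show ?thesis by auto
    qed
    show "decseq B"
      unfolding B_def decseq_def by auto
    show "emeasure half_line (B n) \<noteq> \<infinity>" for n
    proof -
      have "emeasure half_line (B n) \<le> emeasure half_line {x \<in> space half_line. s < cmod (f x)}"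
      proof (rule emeasure_mono)
        show "B n \<subseteq> {x \<in> space half_line. s < cmod (f x)}"
          by (auto simp: B_def)
      qed measurable
      then show ?thesis using s by (auto simp: top_unique)
    qed
  qed
  moreover have "(\<Inter>n. B n) = {}"
  proof -
    have "\<exists>n. x \<notin> B n" for x
    proof -
      obtain n where "cmod (f x) < real n" using reals_Archimedean2 by blast
      then show ?thesis using s by (intro exI[of _ n]) (auto simp: B_def)
    qed
    then show ?thesis by auto
  qed
  ultimately have "(\<lambda>n. emeasure half_line (B n)) \<longlonglongrightarrow> 0"
    by simp
  then have "\<forall>\<^sub>F n in sequentially. emeasure half_line (B n) < ennreal t"
    by (rule order_tendstoD) (use t in simp)
  then obtain n where "emeasure half_line (B n) < ennreal t"
    by (auto simp: eventually_sequentially)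
  then show ?thesis
    using s by (intro exI[of _ "s + real n"]) (auto simp: B_def)
qed

text \<open>A smaller distribution function has more admissible levels \<open>s\<close>, hence a
  smaller infimum. Real \<open>Inf\<close> is monotone in this sense only if the smaller set is
  nonempty, which is where \<open>f \<in> S_space\<close> enters.\<close>

lemma rearrangement_mono:
  assumes f: "f \<in> S_space" and t: "0 < t"
    and le: "\<And>s. 0 \<le> s \<Longrightarrow> emeasure half_line {x \<in> space half_line. s < cmod (g x)}
               \<le> emeasure half_line {x \<in> space half_line. s < cmod (f x)}"
  shows "rearrangement g t \<le> rearrangement f t"
  unfolding rearrangement_def
proof (rule cInf_superset_mono)
  show "{s. 0 \<le> s \<and> emeasure half_line {x \<in> space half_line. s < cmod (f x)} \<le> ennreal t} \<noteq> {}"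
    using rearrangement_bound_exists[OF f t] by auto
  show "bdd_below {s. 0 \<le> s \<and> emeasure half_line {x \<in> space half_line. s < cmod (g x)} \<le> ennreal t}"
    by (rule bdd_belowI[of _ 0]) auto
qed (use le order_trans in blast)

section \<open>Scalar facts: additive functions, powers and Clarkson's inequality\<close>

text \<open>Nonnegativity makes the additive function monotone, so its value at \<open>n * t\<close>
  is pinned between its values at neighbouring integers. Dividing by \<open>n\<close> leaves an
  error of order \<open>1 / n\<close>.\<close>

lemma additive_nonneg_linear:
  fixes \<phi> :: "real \<Rightarrow> real"
  assumes add: "\<And>s t. 0 \<le> s \<Longrightarrow> 0 \<le> t \<Longrightarrow> \<phi> (s + t) = \<phi> s + \<phi> t"
    and nn: "\<And>t. 0 \<le> t \<Longrightarrow> 0 \<le> \<phi> t" and t: "0 \<le> t"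
  shows "\<phi> t = \<phi> 1 * t"
proof -
  have mult: "\<phi> (real n * s) = real n * \<phi> s" if "0 \<le> s" for n s
  proof (induction n)
    case 0
    show ?case using add[of 0 0] by simp
  next
    case (Suc n)
    then show ?case using add[of s "real n * s"] that by (simp add: algebra_simps)
  qed
  have mono: "\<phi> s \<le> \<phi> r" if "0 \<le> s" "s \<le> r" for s r
    using add[of s "r - s"] nn[of "r - s"] that by simp
  have bound: "real n * \<bar>\<phi> t - \<phi> 1 * t\<bar> \<le> \<phi> 1" for n
  proof -
    \<comment> \<open>With \<open>k\<close> the integer part of \<open>n * t\<close>, both
      \<open>n * \<phi> t\<close> and \<open>n * t * \<phi> 1\<close> lie between
      \<open>k * \<phi> 1\<close> and \<open>(k + 1) * \<phi> 1\<close>.\<close>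
    define k where "k = nat \<lfloor>real n * t\<rfloor>"
    have k: "real k \<le> real n * t" "real n * t \<le> real (Suc k)"
      unfolding k_def using t by (auto simp: le_nat_floor of_nat_floor) linarith
    have "real k * \<phi> 1 \<le> real n * \<phi> t"
      using mono[of "real k" "real n * t"] k t mult[of 1 k] mult[of t n] by simp
    moreover have "real n * \<phi> t \<le> real (Suc k) * \<phi> 1"
      using mono[of "real n * t" "real (Suc k)"] k t mult[of 1 "Suc k"] mult[of t n] by simp
    moreover have "real k * \<phi> 1 \<le> real n * t * \<phi> 1" "real n * t * \<phi> 1 \<le> real (Suc k) * \<phi> 1"
      using k nn[of 1] by (auto intro: mult_right_mono)
    ultimately have "\<bar>real n * \<phi> t - real n * t * \<phi> 1\<bar> \<le> \<phi> 1"
      by (simp add: algebra_simps abs_le_iff)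
    also have "real n * \<phi> t - real n * t * \<phi> 1 = real n * (\<phi> t - \<phi> 1 * t)"
      by (simp add: algebra_simps)
    finally show ?thesis
      by (simp add: abs_mult)
  qed
  show ?thesis
  proof (rule ccontr)
    assume "\<phi> t \<noteq> \<phi> 1 * t"
    then have "0 < \<bar>\<phi> t - \<phi> 1 * t\<bar>" by simp
    then obtain n where "\<phi> 1 < real n * \<bar>\<phi> t - \<phi> 1 * t\<bar>"
      using ex_less_of_nat_mult by blast
    with bound[of n] show False by simp
  qed
qed

text \<open>Write \<open>u powr r\<close> as \<open>u * u powr (r - 1)\<close> and enlarge the
  second factor to \<open>(u + v) powr (r - 1)\<close>; the same for \<open>v\<close>.\<close>

lemma powr_add_strict_super:
  fixes u v r :: real
  assumes "0 < u" "0 < v" "1 < r"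
  shows "u powr r + v powr r < (u + v) powr r"
proof -
  have "u powr r = u * u powr (r - 1)" "v powr r = v * v powr (r - 1)"
    "(u + v) powr r = (u + v) * (u + v) powr (r - 1)"
    using assms by (auto simp: powr_mult_base)
  moreover have "u powr (r - 1) < (u + v) powr (r - 1)" "v powr (r - 1) < (u + v) powr (r - 1)"
    using assms by (auto intro!: powr_less_mono2)
  ultimately show ?thesis
    using assms by (simp add: distrib_right add_strict_mono)
qed

lemma powr_add_strict_sub:
  fixes u v r :: real
  assumes "0 < u" "0 < v" "0 < r" "r < 1"
  shows "(u + v) powr r < u powr r + v powr r"
proof -
  have "u powr r = u * u powr (r - 1)" "v powr r = v * v powr (r - 1)"
    "(u + v) powr r = (u + v) * (u + v) powr (r - 1)"
    using assms by (auto simp: powr_mult_base)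
  moreover have "(u + v) powr (r - 1) < u powr (r - 1)" "(u + v) powr (r - 1) < v powr (r - 1)"
    using assms by (auto intro!: powr_less_mono2_neg)
  ultimately show ?thesis
    using assms by (simp add: distrib_right add_strict_mono)
qed

lemma powr_midpoint_convex:
  fixes x y r :: real
  assumes "0 \<le> x" "0 \<le> y" "1 \<le> r"
  shows "2 * ((x + y) / 2) powr r \<le> x powr r + y powr r"
proof (cases "x = 0 \<or> y = 0")
  case True
  \<comment> \<open>If one argument vanishes, the claim reduces to
    \<open>2 powr (1 - r) \<le> 1\<close>; convexity is then invoked at positive points
    only.\<close>
  have "2 * (z / 2) powr r \<le> z powr r" if "0 \<le> z" for z :: real
  proof -
    have "2 * (z / 2) powr r = 2 powr (1 - r) * z powr r"
      using that by (simp add: powr_divide powr_diff)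
    also have "\<dots> \<le> 1 * z powr r"
      using assms by (intro mult_right_mono) (use assms powr_mono[of "1 - r" 0 2] in auto)
    finally show ?thesis by simp
  qed
  from this[of x] this[of y] True assms show ?thesis by auto
next
  case False
  then have "((1 - 1/2) *\<^sub>R x + (1/2) *\<^sub>R y) powr r \<le> (1 - 1/2) * x powr r + (1/2) * y powr r"
    using assms by (intro convex_onD[OF powr_convex]) auto
  moreover have "(1 - 1/2) *\<^sub>R x + (1/2) *\<^sub>R y = (x + y) / 2" by (simp add: field_simps)
  ultimately show ?thesis by (simp add: field_simps)
qed

text \<open>Midpoint convexity for the exponent \<open>1 / r\<close>, applied to
  \<open>x powr r\<close> and \<open>y powr r\<close>, then raised to the power
  \<open>r\<close>.\<close>

lemma powr_midpoint_concave:
  fixes x y r :: real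
  assumes "0 \<le> x" "0 \<le> y" "0 < r" "r \<le> 1"
  shows "x powr r + y powr r \<le> 2 * ((x + y) / 2) powr r"
proof -
  have "2 * ((x powr r + y powr r) / 2) powr (1/r) \<le> (x powr r) powr (1/r) + (y powr r) powr (1/r)"
    using assms by (intro powr_midpoint_convex) auto
  also have "\<dots> = x + y"
    using assms by (simp add: powr_powr)
  finally have "((x powr r + y powr r) / 2) powr (1/r) \<le> (x + y) / 2" by simp
  then have "(((x powr r + y powr r) / 2) powr (1/r)) powr r \<le> ((x + y) / 2) powr r"
    using assms by (intro powr_mono2) auto
  then show ?thesis using assms by (simp add: powr_powr)
qed

text \<open>The difference of the two sides in the pointwise Clarkson inequality. Integrated along
  \<open>T f\<close> and \<open>T g\<close> it is a combination of four norms, so an isometry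
  computes it from \<open>N\<close>.\<close>

definition clarkson_defect :: "real \<Rightarrow> complex \<Rightarrow> complex \<Rightarrow> real" where
  "clarkson_defect p a b =
     cmod (a + b) powr p + cmod (a - b) powr p - 2 * cmod a powr p - 2 * cmod b powr p"

text \<open>
  In terms of squared moduli the parallelogram law reduces Clarkson's inequality to convexity and
  superadditivity of \<open>x powr (p/2)\<close>, or concavity and subadditivity if \<open>p < 2\<close>.
\<close>

lemma clarkson_defect_eq:
  fixes a b :: complex
  shows "clarkson_defect p a b =
    (cmod (a + b))\<^sup>2 powr (p/2) + (cmod (a - b))\<^sup>2 powr (p/2)
      - 2 * (cmod a)\<^sup>2 powr (p/2) - 2 * (cmod b)\<^sup>2 powr (p/2)"
    "((cmod (a + b))\<^sup>2 + (cmod (a - b))\<^sup>2) / 2 = (cmod a)\<^sup>2 + (cmod b)\<^sup>2"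
proof -
  have "(cmod z)\<^sup>2 powr (p/2) = cmod z powr p" for z
    by (cases "z = 0") (simp_all add: powr_powr flip: powr_numeral)
  then show "clarkson_defect p a b =
    (cmod (a + b))\<^sup>2 powr (p/2) + (cmod (a - b))\<^sup>2 powr (p/2)
      - 2 * (cmod a)\<^sup>2 powr (p/2) - 2 * (cmod b)\<^sup>2 powr (p/2)"
    by (simp add: clarkson_defect_def)
  show "((cmod (a + b))\<^sup>2 + (cmod (a - b))\<^sup>2) / 2 = (cmod a)\<^sup>2 + (cmod b)\<^sup>2"
    unfolding cmod_power2 by (simp add: power2_eq_square algebra_simps)
qed

lemma clarkson_defect_pos:
  assumes "2 < p" "a \<noteq> 0" "b \<noteq> 0"
  shows "0 < clarkson_defect p a b"
  using powr_midpoint_convex[of "(cmod (a + b))\<^sup>2" "(cmod (a - b))\<^sup>2" "p/2"]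
    powr_add_strict_super[of "(cmod a)\<^sup>2" "(cmod b)\<^sup>2" "p/2"] assms
  by (simp add: clarkson_defect_eq)

lemma clarkson_defect_neg:
  assumes "1 \<le> p" "p < 2" "a \<noteq> 0" "b \<noteq> 0"
  shows "clarkson_defect p a b < 0"
  using powr_midpoint_concave[of "(cmod (a + b))\<^sup>2" "(cmod (a - b))\<^sup>2" "p/2"]
    powr_add_strict_sub[of "(cmod a)\<^sup>2" "(cmod b)\<^sup>2" "p/2"] assms
  by (simp add: clarkson_defect_eq)

lemma clarkson_defect_zero:
  "a * b = 0 \<Longrightarrow> clarkson_defect p a b = 0"
  by (auto simp: clarkson_defect_def)

text \<open>For fixed \<open>p \<noteq> 2\<close> the defect has a constant sign and vanishes only
  where one of the arguments does. An integral of constant sign that is zero forces the integrand to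
  vanish almost everywhere.\<close>

lemma clarkson_equality_imp_disjoint:
  assumes p: "1 \<le> p" "p \<noteq> 2"
    and int: "integrable M (\<lambda>x. clarkson_defect p (F x) (G x))"
    and eq: "(\<integral>x. clarkson_defect p (F x) (G x) \<partial>M) = 0"
  shows "AE x in M. F x * G x = 0"
proof (cases "2 < p")
  case True
  have D: "0 \<le> clarkson_defect p a b" "clarkson_defect p a b = 0 \<longleftrightarrow> a * b = 0" for a b
    using clarkson_defect_pos[OF True, of a b] clarkson_defect_zero[of a b p] by force+
  have "AE x in M. clarkson_defect p (F x) (G x) = 0"
    using integral_nonneg_eq_0_iff_AE[OF int] eq D(1) by simp
  then show ?thesis by (simp add: D)
next
  case False
  then have *: "p < 2" using p by simp
  have D: "0 \<le> - clarkson_defect p a b" "- clarkson_defect p a b = 0 \<longleftrightarrow> a * b = 0" for a b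
    using clarkson_defect_neg[OF p(1) *, of a b] clarkson_defect_zero[of a b p] by force+
  have "AE x in M. - clarkson_defect p (F x) (G x) = 0"
    using integral_nonneg_eq_0_iff_AE[of M "\<lambda>x. - clarkson_defect p (F x) (G x)"] int eq D(1)
    by simp
  then show ?thesis by (simp only: D)
qed

section \<open>Symmetric function spaces: domination and cutting\<close>

lemma compl_lebesgue: "A \<in> sets lebesgue \<Longrightarrow> -A \<in> sets lebesgue"
  using sets.compl_sets[of A lebesgue] by (simp add: Compl_eq_Diff_UNIV)

lemma borel_measurable_indicator_half_line:
  assumes "A \<in> sets lebesgue"
  shows "(indicator A :: real \<Rightarrow> complex) \<in> borel_measurable half_line"
  by (rule measurable_restrict_space1) (use assms in measurable)

abbreviation cut :: "real set \<Rightarrow> (real \<Rightarrow> complex) \<Rightarrow> real \<Rightarrow> complex" where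
  "cut A f \<equiv> \<lambda>x. indicator A x * f x"

locale symmetric_space =
  fixes E :: "(real \<Rightarrow> complex) set" and N :: "(real \<Rightarrow> complex) \<Rightarrow> real"
  assumes symmetric: "symmetric_function_space E N"
begin

lemma mem_measurable: "f \<in> E \<Longrightarrow> f \<in> borel_measurable half_line"
  and mem_S: "f \<in> E \<Longrightarrow> f \<in> S_space"
  using symmetric by (auto simp: symmetric_function_space_def linear_subspace_def S_space_def)

lemma add_mem: "f \<in> E \<Longrightarrow> g \<in> E \<Longrightarrow> (\<lambda>x. f x + g x) \<in> E"
  and scale_mem: "f \<in> E \<Longrightarrow> (\<lambda>x. c * f x) \<in> E"
  and zero_mem: "(\<lambda>x. 0) \<in> E"
  using symmetric by (auto simp: symmetric_function_space_def linear_subspace_def)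

lemma diff_mem: "f \<in> E \<Longrightarrow> g \<in> E \<Longrightarrow> (\<lambda>x. f x - g x) \<in> E"
  using add_mem[of f "\<lambda>x. -1 * g x"] scale_mem[of g "-1"] by simp

lemma norm_nonneg: "f \<in> E \<Longrightarrow> 0 \<le> N f"
  and norm_eq_0: "f \<in> E \<Longrightarrow> N f = 0 \<longleftrightarrow> (AE x in half_line. f x = 0)"
  and norm_triangle: "f \<in> E \<Longrightarrow> g \<in> E \<Longrightarrow> N (\<lambda>x. f x + g x) \<le> N f + N g"
  and norm_scale: "f \<in> E \<Longrightarrow> N (\<lambda>x. c * f x) = cmod c * N f"
  using symmetric by (auto simp: symmetric_function_space_def complete_norm_on_def norm_on_def)

lemma complete:
  assumes "\<And>n. u n \<in> E" "\<And>e. 0 < e \<Longrightarrow> \<exists>K. \<forall>m\<ge>K. \<forall>n\<ge>K. N (\<lambda>x. u m x - u n x) < e"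
  obtains f where "f \<in> E" "(\<lambda>n. N (\<lambda>x. u n x - f x)) \<longlonglongrightarrow> 0"
  using symmetric assms unfolding symmetric_function_space_def complete_norm_on_def by blast

text \<open>The symmetry axiom restated for distribution functions, which are easier to compute than
  rearrangements. The finite superlevel set required by \<open>S_space\<close> is inherited from
  \<open>f\<close>.\<close>

lemma distribution_dominated:
  assumes f: "f \<in> E" and g: "g \<in> borel_measurable half_line"
    and le: "\<And>s. 0 \<le> s \<Longrightarrow> emeasure half_line {x \<in> space half_line. s < cmod (g x)}
               \<le> emeasure half_line {x \<in> space half_line. s < cmod (f x)}"
  shows "g \<in> E" "N g \<le> N f"
proof -
  obtain s where "s > 0" "emeasure half_line {x \<in> space half_line. s < cmod (f x)} < \<infinity>"
    using mem_S[OF f] by (auto simp: S_space_def)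
  then have gS: "g \<in> S_space"
    using g le[of s] by (auto simp: S_space_def intro!: exI[of _ s])
  have "g \<in> E \<and> N g \<le> N f"
    using symmetric f gS rearrangement_mono[OF mem_S[OF f] _ le]
    unfolding symmetric_function_space_def by blast
  then show "g \<in> E" "N g \<le> N f" by auto
qed

lemma modulus_dominated:
  assumes f: "f \<in> E" and g: "g \<in> borel_measurable half_line"
    and le: "\<And>x. x \<in> space half_line \<Longrightarrow> cmod (g x) \<le> cmod (f x)"
  shows "g \<in> E" "N g \<le> N f"
proof -
  note [measurable] = mem_measurable[OF f] g
  have "emeasure half_line {x \<in> space half_line. s < cmod (g x)}
               \<le> emeasure half_line {x \<in> space half_line. s < cmod (f x)}" for s
  proof (rule emeasure_mono)
    show "{x \<in> space half_line. s < cmod (g x)} \<subseteq> {x \<in> space half_line. s < cmod (f x)}"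
      using le by (auto intro: less_le_trans)
  qed measurable
  then show "g \<in> E" "N g \<le> N f"
    using distribution_dominated[OF f g] by auto
qed

text \<open>Domination in both directions. It is the source of all invariance under multiplication
  by functions of modulus one.\<close>

lemma norm_cong_modulus:
  assumes "f \<in> E" "g \<in> E" "\<And>x. x \<in> space half_line \<Longrightarrow> cmod (g x) = cmod (f x)"
  shows "N g = N f"
  using modulus_dominated(2)[of f g] modulus_dominated(2)[of g f] assms mem_measurable
  by (simp add: antisym)

lemma norm_cong_AE:
  assumes "f \<in> E" "g \<in> borel_measurable half_line" "AE x in half_line. f x = g x"
  shows "g \<in> E" "N g = N f"
  using symmetric_function_space_AE[OF symmetric assms] by auto

lemma cut_mem:
  assumes f: "f \<in> E" and A: "A \<in> sets lebesgue"
  shows "cut A f \<in> E"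
proof (rule modulus_dominated(1)[OF f])
  note [measurable] = mem_measurable[OF f] borel_measurable_indicator_half_line[OF A]
  show "(\<lambda>x. indicator A x * f x) \<in> borel_measurable half_line"
    by measurable
qed (auto simp: indicator_def)

end

section \<open>Isometries onto L_p and the equality case of Clarkson's inequality\<close>

locale Lp_isometric_space = symmetric_space +
  fixes p :: real and T :: "(real \<Rightarrow> complex) \<Rightarrow> (real \<Rightarrow> complex)"
  assumes p: "1 \<le> p"
    and isometry: "surjective_linear_isometry T E N (Lp_space p) (Lp_norm p)"
begin

lemma image_Lp: "f \<in> E \<Longrightarrow> T f \<in> Lp_space p"
  using isometry by (auto simp: surjective_linear_isometry_def)

lemma image_measurable: "f \<in> E \<Longrightarrow> T f \<in> borel_measurable half_line"
  and image_integrable: "f \<in> E \<Longrightarrow> integrable half_line (\<lambda>x. cmod (T f x) powr p)"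
  using image_Lp[of f] by (auto simp: Lp_space_def)

lemma norm_powr: "f \<in> E \<Longrightarrow> N f powr p = (\<integral>x. cmod (T f x) powr p \<partial>half_line)"
proof -
  assume f: "f \<in> E"
  then have "N f = Lp_norm p (T f)"
    using isometry by (auto simp: surjective_linear_isometry_def)
  then show ?thesis
    using p by (simp add: Lp_norm_def powr_powr integral_nonneg_AE)
qed

lemma preimage:
  assumes "h \<in> Lp_space p"
  obtains f where "f \<in> E" "AE x in half_line. T f x = h x"
  using isometry assms unfolding surjective_linear_isometry_def by blast

text \<open>\<open>T\<close> acts on representatives, so its linearity holds only up to null sets;
  additivity and homogeneity are merged here into one almost-everywhere identity.\<close>

lemma linear_AE:
  assumes "f \<in> E" "g \<in> E"
  shows "AE x in half_line. T (\<lambda>y. f y + c * g y) x = T f x + c * T g x"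
proof -
  have "AE x in half_line. T (\<lambda>y. h y + k y) x = T h x + T k x" if "h \<in> E" "k \<in> E" for h k
    using isometry that unfolding surjective_linear_isometry_def by blast
  note this[OF assms(1) scale_mem[OF assms(2), of c]]
  moreover have "AE x in half_line. T (\<lambda>y. c * g y) x = c * T g x"
    using isometry assms unfolding surjective_linear_isometry_def by blast
  ultimately show ?thesis by eventually_elim simp
qed

lemma add_scale_mem: "f \<in> E \<Longrightarrow> g \<in> E \<Longrightarrow> (\<lambda>x. f x + c * g x) \<in> E"
  by (simp add: add_mem scale_mem)

lemma image_eq_0_iff:
  assumes "f \<in> E"
  shows "(AE x in half_line. T f x = 0) \<longleftrightarrow> (AE x in half_line. f x = 0)"
proof -
  have "(AE x in half_line. T f x = 0) \<longleftrightarrow> (\<integral>x. cmod (T f x) powr p \<partial>half_line) = 0"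
    using integral_nonneg_eq_0_iff_AE[OF image_integrable[OF assms]] by simp
  also have "\<dots> \<longleftrightarrow> N f = 0"
    by (simp flip: norm_powr[OF assms])
  finally show ?thesis
    using norm_eq_0[OF assms] by simp
qed

lemma image_eq_iff:
  assumes "f \<in> E" "g \<in> E"
  shows "(AE x in half_line. T f x = T g x) \<longleftrightarrow> (AE x in half_line. f x = g x)"
proof -
  let ?d = "\<lambda>x. f x + (-1) * g x"
  have "?d \<in> E" using assms by (rule add_scale_mem)
  have "AE x in half_line. T ?d x = T f x + (-1) * T g x"
    using assms by (rule linear_AE)
  then have "(AE x in half_line. T f x = T g x) \<longleftrightarrow> (AE x in half_line. T ?d x = 0)"
    by (intro eventually_subst) (auto elim: eventually_mono)
  also have "\<dots> \<longleftrightarrow> (AE x in half_line. ?d x = 0)"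
    by (rule image_eq_0_iff) fact
  finally show ?thesis by simp
qed

text \<open>Almost everywhere the integrand equals the combination of p-th powers for the images of
  \<open>f + g\<close>, \<open>f - g\<close>, \<open>f\<close> and \<open>g\<close>; the isometry
  turns the integral of each into a power of \<open>N\<close>.\<close>

lemma clarkson_defect_integral:
  assumes f: "f \<in> E" and g: "g \<in> E"
  shows "integrable half_line (\<lambda>x. clarkson_defect p (T f x) (T g x))" (is ?I)
    and "(\<integral>x. clarkson_defect p (T f x) (T g x) \<partial>half_line) =
      N (\<lambda>x. f x + g x) powr p + N (\<lambda>x. f x - g x) powr p - 2 * N f powr p - 2 * N g powr p"
      (is ?eq)
proof -
  let ?s = "\<lambda>x. f x + 1 * g x" and ?d = "\<lambda>x. f x + (-1) * g x"
  have E: "?s \<in> E" "?d \<in> E" using f g by (intro add_scale_mem; simp)+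
  let ?D = "\<lambda>x. cmod (T ?s x) powr p + cmod (T ?d x) powr p
      - 2 * cmod (T f x) powr p - 2 * cmod (T g x) powr p"
  have ae: "AE x in half_line. ?D x = clarkson_defect p (T f x) (T g x)"
    using linear_AE[OF f g, of 1] linear_AE[OF f g, of "-1"]
    by eventually_elim (simp add: clarkson_defect_def)
  note [measurable] = image_measurable[OF f] image_measurable[OF g]
  have m: "(\<lambda>x. clarkson_defect p (T f x) (T g x)) \<in> borel_measurable half_line"
    unfolding clarkson_defect_def by measurable
  have i: "integrable half_line ?D"
    using E f g by (intro Bochner_Integration.integrable_diff Bochner_Integration.integrable_add
        integrable_mult_right image_integrable)
  show ?I
    using i ae m integrable_cong_AE[of ?D half_line] borel_measurable_integrable[OF i] by blast
  have "(\<integral>x. clarkson_defect p (T f x) (T g x) \<partial>half_line) = (\<integral>x. ?D x \<partial>half_line)"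
    by (rule integral_cong_AE[OF m borel_measurable_integrable[OF i]])
      (use ae in eventually_elim, simp)
  also have "\<dots> = N ?s powr p + N ?d powr p - 2 * N f powr p - 2 * N g powr p"
    using E f g by (simp add: image_integrable norm_powr)
  finally show ?eq by simp
qed

text \<open>For \<open>p \<noteq> 2\<close>, disjointness of two images is decided by four norms in
  \<open>E\<close> alone, so it passes to every pair with the same four norms.\<close>

lemma disjointness_transfer:
  assumes p2: "p \<noteq> 2" and E: "f \<in> E" "g \<in> E" "u \<in> E" "v \<in> E"
    and N: "N u = N f" "N v = N g" "N (\<lambda>x. u x + v x) = N (\<lambda>x. f x + g x)"
      "N (\<lambda>x. u x - v x) = N (\<lambda>x. f x - g x)"
    and disj: "AE x in half_line. T f x * T g x = 0"
  shows "AE x in half_line. T u x * T v x = 0"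
proof (rule clarkson_equality_imp_disjoint[OF p p2 clarkson_defect_integral(1)])
  have "(\<integral>x. clarkson_defect p (T f x) (T g x) \<partial>half_line) = (\<integral>x. 0 \<partial>half_line)"
  proof (rule integral_cong_AE)
    show "AE x in half_line. clarkson_defect p (T f x) (T g x) = 0"
      using disj by eventually_elim (rule clarkson_defect_zero)
  qed (use clarkson_defect_integral(1)[of f g] E in auto)
  then show "(\<integral>x. clarkson_defect p (T u x) (T v x) \<partial>half_line) = 0"
    using clarkson_defect_integral(2) E N by simp
qed (use E in auto)

section \<open>Cutting to a set and disjointness of images\<close>

lemma disjoint_images_cut:
  assumes p2: "p \<noteq> 2" and f: "f \<in> E" and g: "g \<in> E" and A: "A \<in> sets lebesgue"
    and disj: "AE x in half_line. T f x * T g x = 0"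
  shows "AE x in half_line. T (cut (-A) f) x * T (cut (-A) g) x = 0"
proof -
  note A' = compl_lebesgue[OF A]
  note E = cut_mem[OF f A] cut_mem[OF g A] cut_mem[OF f A'] cut_mem[OF g A']
  \<comment> \<open>\<open>rot l\<close> is multiplication by 1 on \<open>A\<close> and by
    \<open>l\<close> off \<open>A\<close>. For \<open>cmod l = 1\<close> it keeps moduli and
    commutes with sums and differences, so it keeps all four norms.\<close>
  define rot where "rot l h = (\<lambda>x. cut A h x + l * cut (-A) h x)" for l h
  have twist: "AE x in half_line.
      (T (cut A f) x + l * T (cut (-A) f) x) * (T (cut A g) x + l * T (cut (-A) g) x) = 0"
    if l: "cmod l = 1" for l
  proof -
    have rot: "rot l h \<in> E" if "h \<in> E" for h
      unfolding rot_def using that A A' by (intro add_scale_mem cut_mem)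
    have N: "N (rot l h) = N h" if "h \<in> E" for h
      by (rule norm_cong_modulus[OF that rot[OF that]])
        (auto simp: rot_def indicator_def norm_mult l)
    have "N (\<lambda>x. rot l f x + rot l g x) = N (\<lambda>x. f x + g x)"
      using N[OF add_mem[OF f g]] by (simp add: rot_def algebra_simps)
    moreover have "N (\<lambda>x. rot l f x - rot l g x) = N (\<lambda>x. f x - g x)"
      using N[OF diff_mem[OF f g]] by (simp add: rot_def algebra_simps)
    ultimately have "AE x in half_line. T (rot l f) x * T (rot l g) x = 0"
      using disjointness_transfer[OF p2 f g rot[OF f] rot[OF g] N[OF f] N[OF g]] disj by blast
    moreover have "AE x in half_line. T (rot l f) x = T (cut A f) x + l * T (cut (-A) f) x"
      unfolding rot_def by (rule linear_AE[OF E(1) E(3)])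
    moreover have "AE x in half_line. T (rot l g) x = T (cut A g) x + l * T (cut (-A) g) x"
      unfolding rot_def by (rule linear_AE[OF E(2) E(4)])
    ultimately show ?thesis by eventually_elim simp
  qed
  \<comment> \<open>The product is a quadratic in \<open>l\<close> with leading coefficient
    \<open>b * d\<close>. The values at 1 and -1 kill its even and odd parts, and the value at
    \<open>\<i>\<close> separates \<open>a * c\<close> from \<open>b * d\<close>. Three values of
    \<open>l\<close> suffice, so the exceptional set stays null.\<close>
  have poly: "b * d = 0"
    if "(a + 1 * b) * (c + 1 * d) = 0" "(a + (-1) * b) * (c + (-1) * d) = 0"
      "(a + \<i> * b) * (c + \<i> * d) = 0" for a b c d :: complex
  proof -
    have "a * c + b * d = ((a + 1 * b) * (c + 1 * d) + (a + (-1) * b) * (c + (-1) * d)) / 2"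
      and "a * d + b * c = ((a + 1 * b) * (c + 1 * d) - (a + (-1) * b) * (c + (-1) * d)) / 2"
      by (simp_all add: field_simps)
    then have 0: "a * c + b * d = 0" "a * d + b * c = 0"
      unfolding that by simp_all
    have "2 * (b * d) = (a * c + b * d) + \<i> * (a * d + b * c) - (a + \<i> * b) * (c + \<i> * d)"
      by (simp add: algebra_simps)
    also have "\<dots> = 0"
      unfolding that 0 by simp
    finally show ?thesis by simp
  qed
  have "cmod 1 = 1" "cmod (-1) = 1" "cmod \<i> = 1"
    by simp_all
  from this[THEN twist] show ?thesis
    by eventually_elim (rule poly)
qed

lemma cut_Lp:
  assumes "f \<in> Lp_space p" "C \<in> sets lebesgue"
  shows "cut C f \<in> Lp_space p"
proof -
  have f[measurable]: "f \<in> borel_measurable half_line" "integrable half_line (\<lambda>x. cmod (f x) powr p)"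
    using assms(1) by (auto simp: Lp_space_def)
  note [measurable] = borel_measurable_indicator_half_line[OF assms(2)]
  have m: "cut C f \<in> borel_measurable half_line" by measurable
  note [measurable] = m
  have "integrable half_line (\<lambda>x. cmod (cut C f x) powr p)"
    by (rule Bochner_Integration.integrable_bound[OF f(2)]) (measurable, auto simp: indicator_def)
  with m show ?thesis by (simp add: Lp_space_def)
qed

text \<open>Split the image of \<open>cut A f\<close> into its parts on \<open>C\<close> and off
  \<open>C\<close>, with preimages \<open>u\<close> and \<open>v\<close>. Then \<open>u + v\<close>
  vanishes off \<open>A\<close>, and the preceding disjointness shows that \<open>u\<close> and
  \<open>v\<close> vanish there separately.\<close>

lemma image_cut_invariant:
  assumes p2: "p \<noteq> 2" and f: "f \<in> E" and A: "A \<in> sets lebesgue" and C: "C \<in> sets lebesgue"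
  obtains u where "u \<in> E" "AE x in half_line. T (cut A u) x = cut C (T (cut A f)) x"
proof -
  note A' = compl_lebesgue[OF A]
  let ?F = "cut A f"
  have F: "?F \<in> E" by (rule cut_mem[OF f A])
  obtain u where u: "u \<in> E" and Tu: "AE x in half_line. T u x = cut C (T ?F) x"
    using preimage[OF cut_Lp[OF image_Lp[OF F] C]] by blast
  obtain v where v: "v \<in> E" and Tv: "AE x in half_line. T v x = cut (-C) (T ?F) x"
    using preimage[OF cut_Lp[OF image_Lp[OF F] compl_lebesgue[OF C]]] by blast
  have "AE x in half_line. T u x * T v x = 0"
    using Tu Tv by eventually_elim (simp add: indicator_def)
  then have disj: "AE x in half_line. T (cut (-A) u) x * T (cut (-A) v) x = 0"
    by (rule disjoint_images_cut[OF p2 u v A])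
  have "AE x in half_line. T (\<lambda>y. u y + 1 * v y) x = T ?F x"
    using linear_AE[OF u v, of 1] Tu Tv by eventually_elim (simp add: indicator_def)
  then have "AE x in half_line. u x + 1 * v x = ?F x"
    using image_eq_iff[OF add_scale_mem[OF u v, of 1] F] by simp
  then have "AE x in half_line. cut (-A) u x + 1 * cut (-A) v x = 0"
    by eventually_elim (auto simp: indicator_def)
  then have "AE x in half_line. T (\<lambda>x. cut (-A) u x + 1 * cut (-A) v x) x = 0"
    using image_eq_0_iff[OF add_scale_mem[OF cut_mem[OF u A'] cut_mem[OF v A'], of 1]] by simp
  with linear_AE[OF cut_mem[OF u A'] cut_mem[OF v A'], of 1]
  have "AE x in half_line. T (cut (-A) u) x + T (cut (-A) v) x = 0"
    by eventually_elim simp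
  \<comment> \<open>Two functions that are disjoint and opposite to each other are both
    zero.\<close>
  with disj have 0: "AE x in half_line. T (cut (-A) u) x = 0"
    by eventually_elim (auto simp: add_eq_0_iff)
  have "(\<lambda>x. cut A u x + 1 * cut (-A) u x) = u"
    by (auto simp: indicator_def)
  then have "AE x in half_line. T u x = T (cut A u) x + 1 * T (cut (-A) u) x"
    using linear_AE[OF cut_mem[OF u A] cut_mem[OF u A'], of 1] by simp
  with 0 Tu have "AE x in half_line. T (cut A u) x = cut C (T ?F) x"
    by eventually_elim simp
  with u that show ?thesis by blast
qed

text \<open>The functions \<open>cut A f + l * cut (-A) g\<close> have the same norm for all
  unimodular \<open>l\<close>, and this persists after restricting the images to any set
  \<open>C\<close>. Equal integrals over every set force equal moduli.\<close>

lemma image_rotation_le: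
  assumes p2: "p \<noteq> 2" and f: "f \<in> E" and g: "g \<in> E" and A: "A \<in> sets lebesgue"
    and c: "cmod c = 1" and d: "cmod d = 1"
  shows "AE x in half_line. cmod (T (cut A f) x + c * T (cut (-A) g) x)
           \<le> cmod (T (cut A f) x + d * T (cut (-A) g) x)"
proof -
  note A' = compl_lebesgue[OF A]
  let ?F = "T (cut A f)" and ?G = "T (cut (-A) g)"
  note [measurable] = image_measurable[OF cut_mem[OF f A]] image_measurable[OF cut_mem[OF g A']]
  \<comment> \<open>\<open>C\<close> is the set where the claim fails. The difference of p-th powers
    restricted to \<open>C\<close> is nonnegative with integral zero.\<close>
  define C where "C = {x \<in> space half_line. cmod (?F x + d * ?G x) < cmod (?F x + c * ?G x)}"
  have "C \<in> sets half_line" unfolding C_def by measurable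
  then have C: "C \<in> sets lebesgue" by (simp add: sets_restrict_space_iff)
  obtain u where u: "u \<in> E" "AE x in half_line. T (cut A u) x = cut C ?F x"
    using image_cut_invariant[OF p2 f A C] by blast
  obtain v where v: "v \<in> E" "AE x in half_line. T (cut (-A) v) x = cut C ?G x"
    using image_cut_invariant[OF p2 g A' C] by blast
  define w where "w l = (\<lambda>x. cut A u x + l * cut (-A) v x)" for l
  have w: "w l \<in> E" for l
    unfolding w_def by (intro add_scale_mem cut_mem u v A A')
  have Tw: "AE x in half_line. T (w l) x = cut C (\<lambda>x. ?F x + l * ?G x) x" for l
    using linear_AE[OF cut_mem[OF u(1) A] cut_mem[OF v(1) A'], of l] u(2) v(2)
    unfolding w_def by eventually_elim (simp add: algebra_simps)
  have "N (w c) = N (w d)"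
    by (rule norm_cong_modulus[OF w w]) (auto simp: w_def indicator_def norm_mult c d)
  then have 0: "(\<integral>x. cmod (T (w c) x) powr p - cmod (T (w d) x) powr p \<partial>half_line) = 0"
    using w by (simp add: image_integrable flip: norm_powr)
  have "AE x in half_line. 0 \<le> cmod (T (w c) x) powr p - cmod (T (w d) x) powr p"
    using Tw[of c] Tw[of d]
    by eventually_elim (use p in \<open>auto simp: C_def indicator_def intro!: powr_mono2\<close>)
  then have "AE x in half_line. cmod (T (w c) x) powr p - cmod (T (w d) x) powr p = 0"
    using 0 w by (subst integral_nonneg_eq_0_iff_AE[symmetric])
      (auto intro!: Bochner_Integration.integrable_diff image_integrable)
  then show ?thesis
    using Tw[of c] Tw[of d] AE_space[of half_line]
  proof eventually_elim
    case (elim x)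
    show ?case
    proof (rule ccontr)
      assume "\<not> ?thesis"
      then have less: "cmod (?F x + d * ?G x) < cmod (?F x + c * ?G x)" by simp
      then have "cmod (?F x + c * ?G x) powr p = cmod (?F x + d * ?G x) powr p"
        using elim by (simp add: C_def)
      with powr_less_mono2[OF _ _ less, of p] p show False by simp
    qed
  qed
qed

lemma cut_images_disjoint:
  assumes p2: "p \<noteq> 2" and f: "f \<in> E" and g: "g \<in> E" and A: "A \<in> sets lebesgue"
  shows "AE x in half_line. T (cut A f) x * T (cut (-A) g) x = 0"
proof -
  \<comment> \<open>Equal moduli at 1 and -1 give \<open>Re (a * cnj b) = 0\<close>; those at
    \<open>\<i>\<close> and \<open>-\<i>\<close> give \<open>Im (a * cnj b) = 0\<close>.\<close>
  have *: "a * b = 0"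
    if "cmod (a + 1 * b) \<le> cmod (a + (-1) * b)" "cmod (a + (-1) * b) \<le> cmod (a + 1 * b)"
      "cmod (a + \<i> * b) \<le> cmod (a + (-\<i>) * b)" "cmod (a + (-\<i>) * b) \<le> cmod (a + \<i> * b)" for a b
  proof -
    have "(cmod (a + 1 * b))\<^sup>2 = (cmod (a + (-1) * b))\<^sup>2"
      "(cmod (a + \<i> * b))\<^sup>2 = (cmod (a + (-\<i>) * b))\<^sup>2"
      using that by simp_all
    then have "Re (a * cnj b) = 0" "Im (a * cnj b) = 0"
      unfolding cmod_power2 by (auto simp: power2_eq_square algebra_simps)
    then have "a * cnj b = 0" by (simp add: complex_eq_iff)
    then show ?thesis by simp
  qed
  have "cmod 1 = 1" "cmod (-1) = 1" "cmod \<i> = 1" "cmod (-\<i>) = 1"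
    by simp_all
  note rot = image_rotation_le[OF p2 f g A this(1,2)] image_rotation_le[OF p2 f g A this(2,1)]
    image_rotation_le[OF p2 f g A this(3,4)] image_rotation_le[OF p2 f g A this(4,3)]
  from rot show ?thesis
    by eventually_elim (rule *)
qed

text \<open>For \<open>p \<noteq> 2\<close> the two images are disjoint, so the integral splits. For
  \<open>p = 2\<close> the defect is identically zero, and the sum and the difference of the two
  pieces have the same modulus, hence the same norm.\<close>

lemma norm_powr_additive:
  assumes f: "f \<in> E" and A: "A \<in> sets lebesgue"
  shows "N f powr p = N (cut A f) powr p + N (cut (-A) f) powr p"
proof -
  let ?F = "cut A f" and ?G = "cut (-A) f"
  note E = cut_mem[OF f A] cut_mem[OF f compl_lebesgue[OF A]]
  have s: "(\<lambda>x. ?F x + 1 * ?G x) = f" by (auto simp: indicator_def)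
  show ?thesis
  proof (cases "p = 2")
    case True
    have "(\<lambda>x. ?F x + ?G x) = f" using s by simp
    moreover have "N (\<lambda>x. ?F x - ?G x) = N f"
      by (rule norm_cong_modulus[OF f diff_mem[OF E]]) (auto simp: indicator_def)
    moreover have "clarkson_defect 2 a b = 0" for a b
      using clarkson_defect_eq(2)[of a b] unfolding clarkson_defect_eq(1) by simp
    ultimately show ?thesis
      using clarkson_defect_integral(2)[OF E] True by simp
  next
    case False
    have "AE x in half_line. cmod (T f x) powr p = cmod (T ?F x) powr p + cmod (T ?G x) powr p"
      using cut_images_disjoint[OF False f f A] linear_AE[OF E, of 1] unfolding s
      by eventually_elim auto
    then have "(\<integral>x. cmod (T f x) powr p \<partial>half_line) =
        (\<integral>x. cmod (T ?F x) powr p + cmod (T ?G x) powr p \<partial>half_line)"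
      by (intro integral_cong_AE) (auto intro!: borel_measurable_integrable
          Bochner_Integration.integrable_add image_integrable f E)
    then show ?thesis
      using f E by (simp add: norm_powr image_integrable)
  qed
qed

end

section \<open>Indicators in a symmetric space\<close>

lemma sets_half_line_iff: "A \<in> sets half_line \<longleftrightarrow> A \<in> sets lebesgue \<and> A \<subseteq> {0<..}"
  by (auto simp: sets_restrict_space_iff)

lemma emeasure_half_line_Ioc:
  assumes "0 \<le> s" "s \<le> t"
  shows "emeasure half_line {s<..t} = ennreal (t - s)"
proof -
  have "emeasure half_line {s<..t} = emeasure lebesgue {s<..t}"
    by (rule emeasure_restrict_space) (use assms in auto)
  then show ?thesis using assms by simp
qed

lemma Ioc_sets_half_line: "0 \<le> s \<Longrightarrow> {s<..t} \<in> sets half_line"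
  by (auto simp: sets_half_line_iff)

context symmetric_space
begin

text \<open>Each superlevel set of a multiple of an indicator is the whole set or empty, so
  comparing measures and constants compares distribution functions.\<close>

lemma scaled_indicator_dominated:
  assumes A: "A \<in> sets half_line" and B: "B \<in> sets half_line"
    and le: "emeasure half_line A \<le> emeasure half_line B"
    and E: "(\<lambda>x. c * indicator B x) \<in> E" and d: "cmod d \<le> cmod c"
  shows "(\<lambda>x. d * indicator A x) \<in> E" "N (\<lambda>x. d * indicator A x) \<le> N (\<lambda>x. c * indicator B x)"
proof -
  have level: "{x \<in> space half_line. s < cmod (a * indicator X x)} = (if s < cmod a then X else {})"
    if "X \<in> sets half_line" "0 \<le> s" for a :: complex and X s
    using that sets.sets_into_space[OF that(1)] by (auto simp: indicator_def split: if_splits)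
  have "(\<lambda>x. d * indicator A x) \<in> borel_measurable half_line"
    using A by measurable
  moreover have "emeasure half_line {x \<in> space half_line. s < cmod (d * indicator A x)}
      \<le> emeasure half_line {x \<in> space half_line. s < cmod (c * indicator B x)}" if "0 \<le> s" for s
    unfolding level[OF A that] level[OF B that] using le d by auto
  ultimately show "(\<lambda>x. d * indicator A x) \<in> E"
    "N (\<lambda>x. d * indicator A x) \<le> N (\<lambda>x. c * indicator B x)"
    using distribution_dominated[OF E] by blast+
qed

lemmas indicator_dominated = scaled_indicator_dominated[where c = 1 and d = 1, simplified]

lemma norm_indicator_cong:
  assumes "A \<in> sets half_line" "B \<in> sets half_line" "emeasure half_line A = emeasure half_line B"
    and "indicator B \<in> E"
  shows "indicator A \<in> E" "N (indicator A) = N (indicator B)"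
  using indicator_dominated[OF assms(1,2) _ assms(4)] indicator_dominated[OF assms(2,1)] assms(3)
  by (auto intro: antisym)

text \<open>Some set \<open>cmod (f x) > 1 / (n + 1)\<close> has positive measure. A small multiple
  of its indicator is dominated by \<open>f\<close>, and an interval of no larger measure is
  dominated by the set.\<close>

lemma nontrivial_interval_mem:
  assumes f: "f \<in> E" "N f \<noteq> 0"
  shows "\<exists>\<delta>>0. indicator {0<..\<delta>} \<in> E"
proof -
  note [measurable] = mem_measurable[OF f(1)]
  define L where "L n = {x \<in> space half_line. 1 / real (Suc n) < cmod (f x)}" for n
  have L[measurable]: "L n \<in> sets half_line" for n
    unfolding L_def by measurable
  have "\<exists>n. emeasure half_line (L n) \<noteq> 0"
  proof (rule ccontr)
    assume "\<not> ?thesis"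
    then have "\<forall>n. AE x in half_line. x \<notin> L n"
      by (intro allI AE_not_in null_setsI L) auto
    then have "AE x in half_line. \<forall>n. x \<notin> L n"
      by (simp add: AE_all_countable)
    then have "AE x in half_line. f x = 0"
      using AE_space[of half_line]
    proof eventually_elim
      fix x assume x: "\<forall>n. x \<notin> L n" "x \<in> space half_line"
      show "f x = 0"
      proof (rule ccontr)
        assume "f x \<noteq> 0"
        then obtain n where "1 / real (Suc n) < cmod (f x)"
          using nat_approx_posE[of "cmod (f x)"] by auto
        with x show False by (auto simp: L_def)
      qed
    qed
    then show False using norm_eq_0[OF f(1)] f(2) by simp
  qed
  then obtain n where "0 < emeasure half_line (L n)"
    by (auto simp: zero_less_iff_neq_zero)
  \<comment> \<open>The set may have infinite measure; an intermediate value \<open>e\<close> is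
    finite and serves as the length of the interval.\<close>
  then obtain e where "0 < e" "e < emeasure half_line (L n)"
    using dense by blast
  moreover obtain \<delta> where "0 \<le> \<delta>" "e = ennreal \<delta>"
    using \<open>e < _\<close> by (cases e) auto
  ultimately have \<delta>: "0 < \<delta>" "ennreal \<delta> \<le> emeasure half_line (L n)"
    by auto
  have "(\<lambda>x. complex_of_real (1 / real (Suc n)) * indicator (L n) x) \<in> E"
  proof (rule modulus_dominated(1)[OF f(1)])
    show "cmod (complex_of_real (1 / real (Suc n)) * indicator (L n) x) \<le> cmod (f x)" for x
      by (auto simp: L_def indicator_def norm_divide simp del: of_real_divide)
  qed measurable
  then have "(\<lambda>x. of_nat (Suc n) * (complex_of_real (1 / real (Suc n)) * indicator (L n) x)) \<in> E"
    by (rule scale_mem)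
  moreover have "(\<lambda>x. of_nat (Suc n) * (complex_of_real (1 / real (Suc n)) * indicator (L n) x))
      = indicator (L n)"
  proof -
    have "of_nat (Suc n) * complex_of_real (1 / real (Suc n)) = 1"
      by (simp del: of_nat_Suc)
    then show ?thesis by (simp only: mult.assoc[symmetric] mult_1)
  qed
  ultimately have "indicator (L n) \<in> E" by (simp only:)
  then have "indicator {0<..\<delta>} \<in> E"
  proof (rule indicator_dominated(1)[OF Ioc_sets_half_line L, rotated 2])
    show "emeasure half_line {0<..\<delta>} \<le> emeasure half_line (L n)"
      using \<delta> by (simp add: emeasure_half_line_Ioc)
  qed simp
  with \<delta> show ?thesis by blast
qed

text \<open>Translates of one interval have equal measure and add up to arbitrarily long intervals,
  which dominate any set of finite measure.\<close>

lemma indicator_mem: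
  assumes f: "f \<in> E" "N f \<noteq> 0" and A: "A \<in> sets half_line" "emeasure half_line A < \<infinity>"
  shows "indicator A \<in> E"
proof -
  obtain \<delta> where \<delta>: "0 < \<delta>" "indicator {0<..\<delta>} \<in> E"
    using nontrivial_interval_mem[OF f] by blast
  have mult: "indicator {0<..real n * \<delta>} \<in> E" for n
  proof (induction n)
    case 0
    show ?case using zero_mem by (simp add: indicator_def[abs_def])
  next
    case (Suc n)
    have "indicator {real n * \<delta><..real (Suc n) * \<delta>} \<in> E"
      by (rule norm_indicator_cong(1)[OF _ _ _ \<delta>(2)])
        (use \<delta>(1) in \<open>auto simp: emeasure_half_line_Ioc Ioc_sets_half_line algebra_simps\<close>)
    then have "(\<lambda>x. indicator {0<..real n * \<delta>} x + indicator {real n * \<delta><..real (Suc n) * \<delta>} x) \<in> E"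
      by (rule add_mem[OF Suc])
    moreover have "(\<lambda>x. indicator {0<..real n * \<delta>} x + indicator {real n * \<delta><..real (Suc n) * \<delta>} x)
        = (indicator {0<..real (Suc n) * \<delta>} :: real \<Rightarrow> complex)"
    proof -
      have "0 \<le> real n * \<delta>" "real n * \<delta> \<le> real (Suc n) * \<delta>" using \<delta> by auto
      then show ?thesis by (auto simp: indicator_def fun_eq_iff)
    qed
    ultimately show ?case by simp
  qed
  obtain a where a: "0 \<le> a" "emeasure half_line A = ennreal a"
    using A(2) by (cases "emeasure half_line A") auto
  obtain n where "a < real n * \<delta>"
    using ex_less_of_nat_mult[OF \<delta>(1)] by blast
  then have "emeasure half_line A \<le> emeasure half_line {0<..real n * \<delta>}"
    using a by (simp add: emeasure_half_line_Ioc ennreal_leI)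
  then show ?thesis
    by (rule indicator_dominated(1)[OF A(1) Ioc_sets_half_line[OF order_refl] _ mult])
qed

end

section \<open>Spaces with a p-additive norm\<close>

text \<open>The isometry is left behind here: only p-additivity over complementary sets and a
  nonzero element \<open>f0\<close> are kept.\<close>

locale p_additive_space = symmetric_space +
  fixes p :: real and f0 :: "real \<Rightarrow> complex"
  assumes p: "1 \<le> p" and f0: "f0 \<in> E" "N f0 \<noteq> 0"
    and additive: "\<And>f A. f \<in> E \<Longrightarrow> A \<in> sets lebesgue \<Longrightarrow>
      N f powr p = N (cut A f) powr p + N (cut (-A) f) powr p"
begin

definition scale :: real where
  "scale = N (indicator {0<..1}) powr p"

lemma indicator_mem_E:
  "A \<in> sets half_line \<Longrightarrow> emeasure half_line A < \<infinity> \<Longrightarrow> indicator A \<in> E"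
  by (rule indicator_mem[OF f0])

lemma interval_mem: "0 \<le> s \<Longrightarrow> s \<le> t \<Longrightarrow> indicator {s<..t} \<in> E"
  by (rule indicator_mem_E) (auto simp: emeasure_half_line_Ioc Ioc_sets_half_line)

lemma norm_zero: "N (\<lambda>x. 0) = 0"
  using norm_eq_0[OF zero_mem] by simp

text \<open>Cutting at \<open>s\<close> and translating the right-hand piece makes the p-th power of
  the norm an additive function of the length.\<close>

lemma norm_interval:
  assumes "0 \<le> t"
  shows "N (indicator {0<..t}) powr p = scale * t"
  unfolding scale_def
proof (rule additive_nonneg_linear[OF _ _ assms])
  fix s t :: real assume st: "0 \<le> s" "0 \<le> t"
  have "cut {..s} (indicator {0<..s + t}) = indicator {0<..s}"
    "cut (-{..s}) (indicator {0<..s + t}) = indicator {s<..s + t}"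
    using st by (auto simp: indicator_def fun_eq_iff)
  moreover have "N (indicator {s<..s + t}) = N (indicator {0<..t})"
    using st by (intro norm_indicator_cong(2))
      (auto simp: emeasure_half_line_Ioc Ioc_sets_half_line interval_mem)
  ultimately show "N (indicator {0<..s + t}) powr p
      = N (indicator {0<..s}) powr p + N (indicator {0<..t}) powr p"
    using additive[of "indicator {0<..s + t}" "{..s}"] interval_mem[of 0 "s + t"] st by simp
qed simp

lemma norm_indicator:
  assumes A: "A \<in> sets half_line" "emeasure half_line A < \<infinity>"
  shows "N (indicator A) powr p = scale * measure half_line A"
proof -
  obtain a where a: "0 \<le> a" "emeasure half_line A = ennreal a"
    using A(2) by (cases "emeasure half_line A") auto
  have "N (indicator A) = N (indicator {0<..a})"
    using A a by (intro norm_indicator_cong(2))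
      (auto simp: emeasure_half_line_Ioc Ioc_sets_half_line interval_mem)
  then show ?thesis
    using norm_interval[of a] a by (simp add: measure_def)
qed

lemma scale_pos: "0 < scale"
proof -
  have E: "indicator {0<..1} \<in> E" by (rule interval_mem) auto
  have "N (indicator {0<..1}) \<noteq> 0"
  proof
    assume "N (indicator {0<..1}) = 0"
    then have "AE x in half_line. indicator {0<..1} x = (0::complex)"
      using norm_eq_0[OF E] by simp
    then have "AE x in half_line. x \<notin> {0<..1::real}"
      by eventually_elim (auto simp: indicator_def split: if_splits)
    then have "emeasure half_line {0<..1} = 0"
      by (subst (asm) AE_iff_null_sets[symmetric]) (auto simp: Ioc_sets_half_line)
    then show False by (simp add: emeasure_half_line_Ioc)
  qed
  then show ?thesis by (simp add: scale_def)
qed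

text \<open>Induction on the number of sets: cutting to \<open>A j\<close> and to its complement
  separates the new summand from the old sum.\<close>

lemma norm_step_function:
  assumes "finite I" and "disjoint_family_on A I"
    and "\<And>i. i \<in> I \<Longrightarrow> A i \<in> sets half_line" "\<And>i. i \<in> I \<Longrightarrow> emeasure half_line (A i) < \<infinity>"
  shows "(\<lambda>x. \<Sum>i\<in>I. a i * indicator (A i) x) \<in> E \<and>
    N (\<lambda>x. \<Sum>i\<in>I. a i * indicator (A i) x) powr p
      = scale * (\<Sum>i\<in>I. cmod (a i) powr p * measure half_line (A i))"
  using assms
proof (induction I rule: finite_induct)
  case empty
  then show ?case using p by (simp add: zero_mem norm_zero)
next
  case (insert j I)
  have IH: "(\<lambda>x. \<Sum>i\<in>I. a i * indicator (A i) x) \<in> E"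
    "N (\<lambda>x. \<Sum>i\<in>I. a i * indicator (A i) x) powr p
      = scale * (\<Sum>i\<in>I. cmod (a i) powr p * measure half_line (A i))"
    using insert by (auto simp: disjoint_family_on_insert)
  have j: "A j \<in> sets half_line" "emeasure half_line (A j) < \<infinity>" using insert.prems by auto
  note jE = indicator_mem_E[OF j]
  let ?f = "\<lambda>x. \<Sum>i\<in>insert j I. a i * indicator (A i) x"
  have f: "?f \<in> E"
    using add_mem[OF scale_mem[OF jE, of "a j"] IH(1)] by (simp only: sum.insert[OF insert.hyps])
  have disj: "A j \<inter> A i = {}" if "i \<in> I" for i
    using insert.prems(1) insert.hyps that by (auto simp: disjoint_family_on_def)
  have 0: "(\<Sum>i\<in>I. a i * indicator (A i) x) = 0" if "x \<in> A j" for x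
    using disj that by (intro sum.neutral) (auto simp: indicator_def)
  have "cut (A j) ?f = (\<lambda>x. a j * indicator (A j) x)"
    "cut (- A j) ?f = (\<lambda>x. \<Sum>i\<in>I. a i * indicator (A i) x)"
    using 0 insert.hyps by (auto simp: fun_eq_iff indicator_def)
  then have "N ?f powr p = N (\<lambda>x. a j * indicator (A j) x) powr p
      + N (\<lambda>x. \<Sum>i\<in>I. a i * indicator (A i) x) powr p"
    using additive[OF f, of "A j"] j by (simp add: sets_half_line_iff)
  also have "N (\<lambda>x. a j * indicator (A j) x) powr p
      = cmod (a j) powr p * (scale * measure half_line (A j))"
    using norm_scale[OF jE, of "a j"] norm_indicator[OF j] norm_nonneg[OF jE]
    by (simp add: powr_mult)
  finally show ?case
    using f IH(2) insert.hyps by (simp add: algebra_simps)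
qed

lemma norm_simple_function:
  fixes s :: "real \<Rightarrow> real"
  assumes s: "simple_function half_line s"
    and fin: "emeasure half_line {x \<in> space half_line. s x \<noteq> 0} < \<infinity>"
  shows "(\<lambda>x. complex_of_real (s x)) \<in> E"
    "N (\<lambda>x. complex_of_real (s x)) powr p = scale * (\<integral>x. \<bar>s x\<bar> powr p \<partial>half_line)"
proof -
  \<comment> \<open>The value 0 is left out because its level set may have infinite measure.\<close>
  define I where "I = s ` space half_line - {0}"
  define A where "A y = s -` {y} \<inter> space half_line" for y
  have I: "finite I" using s by (simp add: I_def simple_function_def)
  have A: "A y \<in> sets half_line" for y
    unfolding A_def using s by (rule simple_functionD)
  have m: "{x \<in> space half_line. s x \<noteq> 0} \<in> sets half_line"
    using borel_measurable_simple_function[OF s] by measurable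
  have Afin: "emeasure half_line (A y) < \<infinity>" if "y \<in> I" for y
    by (rule le_less_trans[OF emeasure_mono[OF _ m] fin]) (use that in \<open>auto simp: A_def I_def\<close>)
  have disj: "disjoint_family_on A I" by (auto simp: disjoint_family_on_def A_def)
  \<comment> \<open>Stated for general \<open>h\<close> so as to serve both the function itself and
    the p-th power of its modulus.\<close>
  have rep: "(\<Sum>y\<in>I. h y * indicator (A y) x) = h (s x)"
    if x: "x \<in> space half_line" and h: "h 0 = 0" for x and h :: "real \<Rightarrow> 'a::{semiring_1}"
  proof (cases "s x = 0")
    case True
    then show ?thesis by (auto simp: h A_def I_def intro!: sum.neutral)
  next
    case False
    have "(\<Sum>y\<in>I. h y * indicator (A y) x) = (\<Sum>y\<in>I. if y = s x then h y else 0)"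
      using x by (intro sum.cong) (auto simp: A_def)
    then show ?thesis using False x I by (simp add: sum.delta' I_def)
  qed
  have sm: "(\<lambda>x. complex_of_real (s x)) \<in> borel_measurable half_line"
    using borel_measurable_simple_function[OF s] by measurable
  have ae: "AE x in half_line. (\<Sum>y\<in>I. complex_of_real y * indicator (A y) x) = complex_of_real (s x)"
    by (rule AE_I2) (simp add: rep)
  note step = norm_step_function[OF I disj A Afin, of complex_of_real]
  show "(\<lambda>x. complex_of_real (s x)) \<in> E"
    using norm_cong_AE(1)[OF conjunct1[OF step] sm ae] .
  have "(\<integral>x. \<bar>s x\<bar> powr p \<partial>half_line) = (\<integral>x. (\<Sum>y\<in>I. \<bar>y\<bar> powr p * indicator (A y) x) \<partial>half_line)"
    by (intro Bochner_Integration.integral_cong refl) (use p in \<open>simp add: rep\<close>)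
  also have "\<dots> = (\<Sum>y\<in>I. \<bar>y\<bar> powr p * measure half_line (A y))"
    using A Afin by (subst Bochner_Integration.integral_sum) (auto simp: A_def)
  finally show "N (\<lambda>x. complex_of_real (s x)) powr p = scale * (\<integral>x. \<bar>s x\<bar> powr p \<partial>half_line)"
    using norm_cong_AE(2)[OF conjunct1[OF step] sm ae] step by simp
qed

end

section \<open>Fatou's lemma and simple approximation\<close>

lemma fatou_integral_bound:
  fixes g :: "nat \<Rightarrow> 'a \<Rightarrow> real"
  assumes int: "\<And>n. integrable M (g n)" and nonneg: "\<And>n x. 0 \<le> g n x"
    and lim: "AE x in M. (\<lambda>n. g n x) \<longlonglongrightarrow> h x"
    and le: "\<And>n. (\<integral>x. g n x \<partial>M) \<le> B n" and B: "B \<longlonglongrightarrow> b"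
  shows "(\<integral>\<^sup>+x. ennreal (h x) \<partial>M) \<le> ennreal b"
proof -
  have "(\<integral>\<^sup>+x. ennreal (h x) \<partial>M) = (\<integral>\<^sup>+x. liminf (\<lambda>n. ennreal (g n x)) \<partial>M)"
  proof (rule nn_integral_cong_AE)
    show "AE x in M. ennreal (h x) = liminf (\<lambda>n. ennreal (g n x))"
      using lim by eventually_elim (auto intro!: lim_imp_Liminf[symmetric] tendsto_ennrealI)
  qed
  also have "\<dots> \<le> liminf (\<lambda>n. \<integral>\<^sup>+x. ennreal (g n x) \<partial>M)"
    using int by (intro nn_integral_liminf) (auto dest: borel_measurable_integrable)
  also have "\<dots> \<le> liminf (\<lambda>n. ennreal (B n))"
    using int nonneg le by (intro Liminf_mono) (simp add: nn_integral_eq_integral ennreal_leI)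
  also have "\<dots> = ennreal b"
    using B by (simp add: lim_imp_Liminf tendsto_ennrealI)
  finally show ?thesis .
qed

lemma modulus_simple_approximation:
  assumes f[measurable]: "f \<in> borel_measurable half_line"
  obtains s :: "nat \<Rightarrow> real \<Rightarrow> real" where
    "\<And>n. simple_function half_line (s n)"
    "\<And>n. emeasure half_line {x \<in> space half_line. s n x \<noteq> 0} < \<infinity>"
    "\<And>n x. 0 \<le> s n x" "\<And>m n x. m \<le> n \<Longrightarrow> s m x \<le> s n x"
    "\<And>n x. s n x \<le> cmod (f x)"
    "\<And>x. 0 < x \<Longrightarrow> (\<lambda>n. s n x) \<longlonglongrightarrow> cmod (f x)"
proof -
  have "(\<lambda>x. ennreal (cmod (f x))) \<in> borel_measurable half_line" by measurable
  from borel_measurable_implies_simple_function_sequence'[OF this]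
  obtain F where F: "\<And>i. simple_function half_line (F i)" "incseq F" "\<And>i x. F i x < top"
      "\<And>x. (SUP i. F i x) = ennreal (cmod (f x))"
    by blast
  \<comment> \<open>Truncation to \<open>{0<..real n}\<close> makes the support of finite measure
    and still exhausts the half-line.\<close>
  define s where "s n x = enn2real (F n x) * indicator {0<..real n} x" for n x
  have le: "F n x \<le> ennreal (cmod (f x))" for n x
    using SUP_upper[of n UNIV "\<lambda>i. F i x"] F(4)[of x] by simp
  show thesis
  proof
    show "simple_function half_line (s n)" for n
      unfolding s_def
      by (intro simple_function_mult simple_function_compose1[where g = enn2real] F(1)
          simple_function_indicator Ioc_sets_half_line) simp
    then have [measurable]: "s n \<in> borel_measurable half_line" for n
      by (rule borel_measurable_simple_function)
    show "emeasure half_line {x \<in> space half_line. s n x \<noteq> 0} < \<infinity>" for n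
    proof (rule le_less_trans)
      show "emeasure half_line {x \<in> space half_line. s n x \<noteq> 0} \<le> emeasure half_line {0<..real n}"
        by (rule emeasure_mono) (auto simp: s_def indicator_def Ioc_sets_half_line)
    qed (simp add: emeasure_half_line_Ioc)
    show "0 \<le> s n x" for n x by (simp add: s_def)
    show "s m x \<le> s n x" if "m \<le> n" for m n x
      unfolding s_def using that F(2,3)
      by (intro mult_mono enn2real_mono) (auto simp: incseq_def le_fun_def indicator_def)
    show "s n x \<le> cmod (f x)" for n x
      using enn2real_mono[OF le[of n x]] by (auto simp: s_def indicator_def)
    show "(\<lambda>n. s n x) \<longlonglongrightarrow> cmod (f x)" if "0 < x" for x
    proof -
      have "(\<lambda>n. F n x) \<longlonglongrightarrow> ennreal (cmod (f x))"
        using LIMSEQ_SUP[of "\<lambda>n. F n x"] F(2,4) by (auto simp: incseq_def le_fun_def)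
      then have "(\<lambda>n. enn2real (F n x)) \<longlonglongrightarrow> cmod (f x)"
        by (rule tendsto_enn2real) simp
      moreover have "\<forall>\<^sub>F n in sequentially. enn2real (F n x) = s n x"
        using eventually_ge_at_top[of "nat \<lceil>x\<rceil>"]
      proof eventually_elim
        case (elim n)
        then have "x \<le> real n" by linarith
        then show ?case using that by (simp add: s_def)
      qed
      ultimately show ?thesis by (rule Lim_transform_eventually)
    qed
  qed
qed

section \<open>Comparison with the norm of L_p\<close>

context p_additive_space
begin

text \<open>Simple functions below the modulus of \<open>f\<close> have norm at most
  \<open>N f\<close>, and their norms are known; Fatou's lemma carries the bound over to
  \<open>f\<close>. This embeds \<open>E\<close> into L_p.\<close>

lemma norm_powr_lower_bound:
  assumes f: "f \<in> E"
  shows "integrable half_line (\<lambda>x. cmod (f x) powr p)"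
    and "scale * (\<integral>x. cmod (f x) powr p \<partial>half_line) \<le> N f powr p"
proof -
  note [measurable] = mem_measurable[OF f]
  obtain s :: "nat \<Rightarrow> real \<Rightarrow> real" where s: "\<And>n. simple_function half_line (s n)"
    "\<And>n. emeasure half_line {x \<in> space half_line. s n x \<noteq> 0} < \<infinity>"
    "\<And>n x. 0 \<le> s n x" "\<And>m n x. m \<le> n \<Longrightarrow> s m x \<le> s n x" "\<And>n x. s n x \<le> cmod (f x)"
    "\<And>x. 0 < x \<Longrightarrow> (\<lambda>n. s n x) \<longlonglongrightarrow> cmod (f x)"
    using modulus_simple_approximation[OF mem_measurable[OF f]] by blast
  note simple = norm_simple_function[OF s(1,2)]
  have bound: "(\<integral>x. \<bar>s n x\<bar> powr p \<partial>half_line) \<le> N f powr p / scale" for n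
  proof -
    have "N (\<lambda>x. complex_of_real (s n x)) \<le> N f"
      by (rule modulus_dominated(2)[OF f mem_measurable[OF simple(1)]]) (simp add: s)
    then have "N (\<lambda>x. complex_of_real (s n x)) powr p \<le> N f powr p"
      using p norm_nonneg[OF simple(1)[of n]] by (intro powr_mono2) auto
    then show ?thesis
      using scale_pos unfolding simple(2) by (simp add: field_simps)
  qed
  have int: "integrable half_line (\<lambda>x. \<bar>s n x\<bar> powr p)" for n
  proof (rule integrableI_simple_bochner_integrable[OF simple_bochner_integrable.intros])
    show "simple_function half_line (\<lambda>x. \<bar>s n x\<bar> powr p)"
      using s(1) by (rule simple_function_compose1)
    show "emeasure half_line {x \<in> space half_line. \<bar>s n x\<bar> powr p \<noteq> 0} \<noteq> \<infinity>"
      using s(2)[of n] by simp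
  qed
  have lim: "AE x in half_line. (\<lambda>n. \<bar>s n x\<bar> powr p) \<longlonglongrightarrow> cmod (f x) powr p"
  proof (rule AE_I2)
    fix x assume "x \<in> space half_line"
    then have "(\<lambda>n. s n x) \<longlonglongrightarrow> cmod (f x)" by (intro s(6)) simp
    then show "(\<lambda>n. \<bar>s n x\<bar> powr p) \<longlonglongrightarrow> cmod (f x) powr p"
      using p s(3) by (intro tendsto_powr') (auto intro!: always_eventually)
  qed
  have nn: "(\<integral>\<^sup>+x. ennreal (cmod (f x) powr p) \<partial>half_line) \<le> ennreal (N f powr p / scale)"
    by (rule fatou_integral_bound[OF int _ lim bound tendsto_const]) simp
  show int_f: "integrable half_line (\<lambda>x. cmod (f x) powr p)"
    using nn by (intro integrableI_nonneg) (auto simp: top_unique less_top[symmetric])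
  have "(\<integral>x. cmod (f x) powr p \<partial>half_line) \<le> N f powr p / scale"
    using nn scale_pos by (simp add: nn_integral_eq_integral[OF int_f])
  then show "scale * (\<integral>x. cmod (f x) powr p \<partial>half_line) \<le> N f powr p"
    using scale_pos by (simp add: field_simps)
qed

text \<open>Simple functions increasing to the modulus of \<open>f\<close> form a Cauchy sequence
  for \<open>N\<close>. Completeness yields a limit \<open>g\<close>, which is identified with the
  modulus; \<open>f\<close> follows by symmetry and its norm by continuity.\<close>

lemma Lp_mem:
  assumes f: "f \<in> Lp_space p"
  shows "f \<in> E" and "N f powr p = scale * (\<integral>x. cmod (f x) powr p \<partial>half_line)"
proof -
  have fm[measurable]: "f \<in> borel_measurable half_line"
    and fi: "integrable half_line (\<lambda>x. cmod (f x) powr p)"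
    using f by (auto simp: Lp_space_def)
  obtain s :: "nat \<Rightarrow> real \<Rightarrow> real" where s: "\<And>n. simple_function half_line (s n)"
    "\<And>n. emeasure half_line {x \<in> space half_line. s n x \<noteq> 0} < \<infinity>"
    "\<And>n x. 0 \<le> s n x" "\<And>m n x. m \<le> n \<Longrightarrow> s m x \<le> s n x" "\<And>n x. s n x \<le> cmod (f x)"
    "\<And>x. 0 < x \<Longrightarrow> (\<lambda>n. s n x) \<longlonglongrightarrow> cmod (f x)"
    using modulus_simple_approximation[OF fm] by blast
  have [measurable]: "s n \<in> borel_measurable half_line" for n
    using s(1) by (rule borel_measurable_simple_function)
  note simple = norm_simple_function[OF s(1,2)]
  define u where "u n = (\<lambda>x. complex_of_real (s n x))" for n
  have u: "u n \<in> E" "N (u n) powr p = scale * (\<integral>x. \<bar>s n x\<bar> powr p \<partial>half_line)" for n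
    unfolding u_def by (rule simple)+
  define e where "e n = (\<integral>x. (cmod (f x) - s n x) powr p \<partial>half_line)" for n
  have lim: "AE x in half_line. (\<lambda>n. s n x) \<longlonglongrightarrow> cmod (f x)"
    by (rule AE_I2) (simp add: s(6))
  have bd: "(cmod (f x) - s n x) powr p \<le> cmod (f x) powr p" "\<bar>s n x\<bar> powr p \<le> cmod (f x) powr p" for n x
    using p s(3,5)[of n x] by (auto intro!: powr_mono2)
  have int_e: "integrable half_line (\<lambda>x. (cmod (f x) - s n x) powr p)" for n
    by (rule Bochner_Integration.integrable_bound[OF fi]) (use bd in auto)
  have "e \<longlonglongrightarrow> (\<integral>x. 0 \<partial>half_line)"
    unfolding e_def
  proof (rule integral_dominated_convergence[OF _ _ fi])
    show "AE x in half_line. (\<lambda>n. (cmod (f x) - s n x) powr p) \<longlonglongrightarrow> 0"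
      using lim
    proof eventually_elim
      case (elim x)
      then have "(\<lambda>n. (cmod (f x) - s n x) powr p) \<longlonglongrightarrow> (cmod (f x) - cmod (f x)) powr p"
        using p s(5) by (intro tendsto_powr' tendsto_intros) (auto intro!: always_eventually)
      then show ?case by simp
    qed
  qed (use bd in auto)
  then have e0: "e \<longlonglongrightarrow> 0" by simp
  \<comment> \<open>For \<open>m\<close> and \<open>n\<close> beyond \<open>K\<close>, both
    \<open>s m x\<close> and \<open>s n x\<close> lie between \<open>s K x\<close> and
    \<open>cmod (f x)\<close>, so their distance is at most
    \<open>cmod (f x) - s K x\<close>.\<close>
  have cauchy: "N (\<lambda>x. u m x - u n x) powr p \<le> scale * e K" if K: "K \<le> m" "K \<le> n" for K m n
  proof -
    have "simple_function half_line (\<lambda>x. s m x - s n x)"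
      by (intro simple_function_diff s)
    moreover have "emeasure half_line {x \<in> space half_line. s m x - s n x \<noteq> 0} < \<infinity>"
    proof -
      let ?S = "\<lambda>k. {x \<in> space half_line. s k x \<noteq> 0}"
      have S: "?S k \<in> sets half_line" for k by measurable
      have "emeasure half_line {x \<in> space half_line. s m x - s n x \<noteq> 0}
          \<le> emeasure half_line (?S m \<union> ?S n)"
        using S by (intro emeasure_mono) auto
      also have "\<dots> \<le> emeasure half_line (?S m) + emeasure half_line (?S n)"
        using S by (intro emeasure_subadditive)
      also have "\<dots> < \<infinity>"
        using s(2)[of m] s(2)[of n] by (simp only: infinity_ennreal_def ennreal_add_less_top)
      finally show ?thesis .
    qed
    ultimately have "N (\<lambda>x. complex_of_real (s m x - s n x)) powr p
        = scale * (\<integral>x. \<bar>s m x - s n x\<bar> powr p \<partial>half_line)"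
      by (rule norm_simple_function(2))
    also have "\<dots> \<le> scale * e K"
    proof (rule mult_left_mono)
      have *: "\<bar>s m x - s n x\<bar> powr p \<le> (cmod (f x) - s K x) powr p" for x
        using p s(4)[OF K(1), of x] s(4)[OF K(2), of x] s(5)[of m x] s(5)[of n x]
        by (intro powr_mono2) auto
      show "(\<integral>x. \<bar>s m x - s n x\<bar> powr p \<partial>half_line) \<le> e K"
        unfolding e_def
        by (rule integral_mono'[OF int_e *]) simp
    qed (use scale_pos in simp)
    finally show ?thesis by (simp add: u_def)
  qed
  have "\<exists>K. \<forall>m\<ge>K. \<forall>n\<ge>K. N (\<lambda>x. u m x - u n x) < \<epsilon>" if \<epsilon>: "0 < \<epsilon>" for \<epsilon>
  proof -
    have "0 < \<epsilon> powr p / scale" using scale_pos \<epsilon> by simp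
    then have "\<forall>\<^sub>F n in sequentially. e n < \<epsilon> powr p / scale"
      using e0 by (rule order_tendstoD(2)[rotated])
    then obtain K where "e K < \<epsilon> powr p / scale"
      by (auto simp: eventually_sequentially)
    then have eK: "scale * e K < \<epsilon> powr p" using scale_pos by (simp add: field_simps)
    have "N (\<lambda>x. u m x - u n x) < \<epsilon>" if "K \<le> m" "K \<le> n" for m n
    proof (rule ccontr)
      assume "\<not> ?thesis"
      then have "\<epsilon> powr p \<le> N (\<lambda>x. u m x - u n x) powr p"
        using p \<epsilon> by (intro powr_mono2) auto
      with cauchy[OF that] eK show False by simp
    qed
    then show ?thesis by blast
  qed
  then obtain g where g: "g \<in> E" and ug: "(\<lambda>n. N (\<lambda>x. u n x - g x)) \<longlonglongrightarrow> 0"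
    using complete[of u] u(1) by blast
  note [measurable] = mem_measurable[OF g]
  \<comment> \<open>Convergence in \<open>N\<close> says nothing pointwise by itself. The lower
    bound applied to \<open>u n - g\<close>, together with Fatou's lemma, makes the L_p distance
    from \<open>g\<close> to the modulus of \<open>f\<close> zero.\<close>
  have d: "(\<lambda>x. u n x - g x) \<in> E" for n by (rule diff_mem[OF u(1) g])
  have "(\<integral>\<^sup>+x. ennreal (cmod (complex_of_real (cmod (f x)) - g x) powr p) \<partial>half_line) \<le> ennreal (0 powr p / scale)"
  proof (rule fatou_integral_bound[OF norm_powr_lower_bound(1)[OF d]])
    show "AE x in half_line. (\<lambda>n. cmod (u n x - g x) powr p)
        \<longlonglongrightarrow> cmod (complex_of_real (cmod (f x)) - g x) powr p"
      using lim unfolding u_def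
      by eventually_elim (use p in \<open>auto intro!: tendsto_powr' tendsto_intros always_eventually\<close>)
    show "(\<integral>x. cmod (u n x - g x) powr p \<partial>half_line) \<le> N (\<lambda>x. u n x - g x) powr p / scale" for n
      using norm_powr_lower_bound(2)[OF d, of n] scale_pos by (simp add: field_simps)
    show "(\<lambda>n. N (\<lambda>x. u n x - g x) powr p / scale) \<longlonglongrightarrow> 0 powr p / scale"
      using ug p scale_pos d norm_nonneg
      by (intro tendsto_intros tendsto_powr') (auto intro!: always_eventually)
  qed simp
  then have "(\<integral>\<^sup>+x. ennreal (cmod (complex_of_real (cmod (f x)) - g x) powr p) \<partial>half_line) = 0"
    by simp
  then have "AE x in half_line. ennreal (cmod (complex_of_real (cmod (f x)) - g x) powr p) = 0"
    by (subst (asm) nn_integral_0_iff_AE) auto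
  then have ae: "AE x in half_line. g x = complex_of_real (cmod (f x))"
    by eventually_elim (use p in auto)
  have "(\<lambda>x. complex_of_real (cmod (f x))) \<in> borel_measurable half_line" by measurable
  note abs = norm_cong_AE[OF g this ae]
  show fE: "f \<in> E"
    by (rule modulus_dominated(1)[OF abs(1) fm]) simp
  have Nf: "N f = N g"
    using norm_cong_modulus[OF fE abs(1)] abs(2) by simp
  have "(\<lambda>n. N (u n)) \<longlonglongrightarrow> N g"
  proof (rule LIM_zero_cancel, rule Lim_null_comparison[OF _ ug])
    show "\<forall>\<^sub>F n in sequentially. norm (N (u n) - N g) \<le> N (\<lambda>x. u n x - g x)"
    proof (rule always_eventually, rule allI)
      fix n
      have "N (\<lambda>x. g x - u n x) = N (\<lambda>x. u n x - g x)"
        by (rule norm_cong_modulus[OF d diff_mem[OF g u(1)]]) (simp add: norm_minus_commute)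
      then show "norm (N (u n) - N g) \<le> N (\<lambda>x. u n x - g x)"
        using norm_triangle[OF d[of n] g] norm_triangle[OF diff_mem[OF g u(1)[of n]] u(1)[of n]]
        by simp
    qed
  qed
  then have "(\<lambda>n. N (u n) powr p) \<longlonglongrightarrow> N g powr p"
    using p u norm_nonneg by (intro tendsto_powr') (auto intro!: always_eventually)
  moreover have "(\<lambda>n. N (u n) powr p) \<longlonglongrightarrow> scale * (\<integral>x. cmod (f x) powr p \<partial>half_line)"
    unfolding u(2)
  proof (intro tendsto_intros integral_dominated_convergence[OF _ _ fi])
    show "AE x in half_line. (\<lambda>n. \<bar>s n x\<bar> powr p) \<longlonglongrightarrow> cmod (f x) powr p"
      using lim
    proof eventually_elim
      case (elim x)
      then have "(\<lambda>n. \<bar>s n x\<bar>) \<longlonglongrightarrow> cmod (f x)" using s(3) by simp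
      then show ?case
        using p by (intro tendsto_powr') (auto intro!: always_eventually)
    qed
  qed (use bd in auto)
  ultimately show "N f powr p = scale * (\<integral>x. cmod (f x) powr p \<partial>half_line)"
    unfolding Nf by (rule LIMSEQ_unique)
qed

lemma eq_Lp:
  shows "E = Lp_space p" and "f \<in> E \<Longrightarrow> N f = scale powr (1 / p) * Lp_norm p f"
proof -
  have sub: "E \<subseteq> Lp_space p"
    unfolding Lp_space_def using norm_powr_lower_bound(1) mem_measurable by blast
  show "E = Lp_space p"
    using sub Lp_mem(1) by blast
  assume f: "f \<in> E"
  have "N f = (N f powr p) powr (1 / p)"
    using p norm_nonneg[OF f] by (simp add: powr_powr)
  also have "\<dots> = (scale * (\<integral>x. cmod (f x) powr p \<partial>half_line)) powr (1 / p)"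
    using Lp_mem(2) f sub by (metis subsetD)
  also have "\<dots> = scale powr (1 / p) * Lp_norm p f"
    using scale_pos by (simp add: powr_mult Lp_norm_def)
  finally show "N f = scale powr (1 / p) * Lp_norm p f" .
qed

end

theorem corollary8p2p2:
  fixes p :: real
    and E :: "(real \<Rightarrow> complex) set"
    and N :: "(real \<Rightarrow> complex) \<Rightarrow> real"
  assumes "1 \<le> p"
    and "symmetric_function_space E N"
    and "isometric_spaces E N (Lp_space p) (Lp_norm p)"
  shows "E = Lp_space p \<and> (\<exists>c>0. \<forall>f\<in>E. N f = c * Lp_norm p f)"
proof -
  obtain T where "surjective_linear_isometry T E N (Lp_space p) (Lp_norm p)"
    using assms(3) by (auto simp: isometric_spaces_def)
  then interpret Lp_isometric_space E N p T
    using assms by unfold_locales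
  \<comment> \<open>A preimage of this nonzero element of L_p shows that \<open>E\<close> is not the
    zero space.\<close>
  let ?h = "indicator {0<..1} :: real \<Rightarrow> complex"
  have pow: "cmod (?h x) powr p = indicator {0<..1} x" for x
    using p by (simp add: indicator_def)
  have fin: "emeasure half_line {0<..1} = 1"
    by (simp add: emeasure_half_line_Ioc)
  have "?h \<in> Lp_space p"
    unfolding Lp_space_def mem_Collect_eq pow
    using Ioc_sets_half_line[of 0 1] fin
    by (auto intro!: borel_measurable_indicator integrable_real_indicator)
  then obtain f0 where f0: "f0 \<in> E" "AE x in half_line. T f0 x = ?h x"
    by (rule preimage)
  have "N f0 \<noteq> 0"
  proof
    assume "N f0 = 0"
    then have "AE x in half_line. T f0 x = 0"
      using image_eq_0_iff[OF f0(1)] norm_eq_0[OF f0(1)] by simp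
    with f0(2) have "AE x in half_line. x \<notin> {0<..1::real}"
      by eventually_elim (auto simp: indicator_def split: if_splits)
    then have "emeasure half_line {0<..1} = 0"
      by (subst (asm) AE_iff_null_sets[symmetric]) (auto simp: Ioc_sets_half_line)
    with fin show False by simp
  qed
  then interpret p_additive_space E N p f0
    using p f0(1) norm_powr_additive by unfold_locales auto
  show ?thesis
    using eq_Lp scale_pos by (intro conjI exI[of _ "scale powr (1 / p)"]) auto
qed

end
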